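(* Let $\epsilon>0$, let $n,m$ be integers with $n$ even and $m>2n$ (and $m\le \binom n2$, so that simple graphs with $n$ vertices and $m$ edges exist), and let $\delta\in[0,1]$ satisfy $\delta\le (n/m)^{\Omega(1)}$. Then there exist a graph topology $F=(V,E)$ with $n$ vertices and $m$ edges (containing a perfect matching) and a probability distribution $\mathcal{D}_\omega$ on weight vectors $\mathbf{w}\in\mathbb{R}^{E}$ such that for every $(\epsilon,\delta)$-differentially private (under the $\ell_1$ neighboring relation on weights) randomized algorithm $\mathcal{B}$ that, on input $(F,\mathbf{w})$, outputs a perfect matching $M$ of $F$ (an approximate minimum-weight perfect matching), if $\mathbf{w}\sim\mathcal{D}_\omega$ then the expected additive error satisfies $$\mathbb{E}\big[w(M)-w(M^* )\big]\ \ge\ \Omega\Big(\frac{n}{\epsilon}\cdot\min\big(\ln(1/\delta),\,\ln(m/n)\big)\Big),$$ where $M^*$ is a minimum-weight perfect matching of $F$ with respect to $\mathbf{w}$ and the expectation is over $\mathbf{w}\sim\mathcal{D}_\omega$ and the randomness of $\mathcal{B}$.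
   Context: Graphs are finite, simple, undirected and connected; the topology $F=(V,E)$ is public and only the edge weights are private. For $S\subseteq E$, $w(S)=\sum_{e\in S}w(e)$. A perfect matching is a set of pairwise vertex-disjoint edges covering every vertex. Two weight vectors $\mathbf{w},\mathbf{w}'\in\mathbb{R}^E$ on the same topology are neighboring if $\|\mathbf{w}-\mathbf{w}'\|_1\le 1$. A randomized algorithm $\mathcal{B}$ is $(\epsilon,\delta)$-differentially private if for all neighboring $\mathbf{w},\mathbf{w}'$ and all sets $Y$ of outputs, $\Pr[\mathcal{B}(F,\mathbf{w})\in Y]\le e^{\epsilon}\Pr[\mathcal{B}(F,\mathbf{w}')\in Y]+\delta$. Asymptotic notation: $\epsilon>0$ is a fixed parameter and $n,m$ are the asymptotic parameters; $\delta\le(n/m)^{\Omega(1)}$ means $\delta\le (n/m)^{\gamma}$ for a fixed constant $\gamma>0$; $\Omega(\cdot)$ in the conclusion hides a positive constant factor that does not depend on $n,m,\delta$. For $\delta=0$, $\ln(1/\delta)=+\infty$. *)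

theory Defs
  imports "HOL-Probability.Probability"
begin

type_synonym 'v graph = "'v set \<times> 'v set set"

abbreviation verts :: "'v graph \<Rightarrow> 'v set" where "verts \<equiv> fst"
abbreviation edges :: "'v graph \<Rightarrow> 'v set set" where "edges \<equiv> snd"

definition simple_graph :: "'v graph \<Rightarrow> bool" where
  "simple_graph F \<longleftrightarrow>
     finite (verts F) \<and> (\<forall>e\<in>edges F. e \<subseteq> verts F \<and> card e = 2)"

definition connected_graph :: "'v graph \<Rightarrow> bool" where
  "connected_graph F \<longleftrightarrow>
     (\<forall>u\<in>verts F. \<forall>v\<in>verts F. (u, v) \<in> {(x, y). {x, y} \<in> edges F}\<^sup>*)"

definition perfect_matching :: "'v graph \<Rightarrow> 'v set set \<Rightarrow> bool" where
  "perfect_matching F M \<longleftrightarrow> M \<subseteq> edges F \<and> disjoint M \<and> \<Union>M = verts F"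

text \<open>The measurable space of weight vectors. Its carrier consists of the functions on edge
  sets that are \<^const>\<open>undefined\<close> outside the edges of the topology, so it is a copy
  of the real vectors indexed by the edges, with the Borel sets.\<close>

definition weight_space :: "'v graph \<Rightarrow> ('v set \<Rightarrow> real) measure" where
  "weight_space F = Pi\<^sub>M (edges F) (\<lambda>_. borel)"

definition neighboring :: "'v graph \<Rightarrow> ('v set \<Rightarrow> real) \<Rightarrow> ('v set \<Rightarrow> real) \<Rightarrow> bool" where
  "neighboring F w w' \<longleftrightarrow> (\<Sum>e\<in>edges F. \<bar>w e - w' e\<bar>) \<le> 1"

definition min_weight_pm :: "'v graph \<Rightarrow> ('v set \<Rightarrow> real) \<Rightarrow> 'v set set" where
  "min_weight_pm F w = arg_min_on (\<lambda>M. sum w M) {M. perfect_matching F M}"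

text \<open>A randomized algorithm gets the public topology and the private weights. There are only
  finitely many possible outputs, so a \<^typ>\<open>'a pmf\<close> describes every output
  distribution.\<close>

type_synonym 'v algorithm = "'v graph \<Rightarrow> ('v set \<Rightarrow> real) \<Rightarrow> 'v set set pmf"

definition outputs_perfect_matching :: "'v graph \<Rightarrow> 'v algorithm \<Rightarrow> bool" where
  "outputs_perfect_matching F B \<longleftrightarrow>
     (\<forall>w\<in>space (weight_space F). \<forall>M\<in>set_pmf (B F w). perfect_matching F M)"

definition differentially_private :: "real \<Rightarrow> real \<Rightarrow> 'v graph \<Rightarrow> 'v algorithm \<Rightarrow> bool" where
  "differentially_private \<epsilon> \<delta> F B \<longleftrightarrow>
     (\<forall>w\<in>space (weight_space F). \<forall>w'\<in>space (weight_space F). neighboring F w w' \<longrightarrow>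
        (\<forall>Y. measure_pmf.prob (B F w) Y \<le> exp \<epsilon> * measure_pmf.prob (B F w') Y + \<delta>))"

text \<open>The error of a perfect matching is nonnegative, so its expectation is taken in
  \<^typ>\<open>ennreal\<close>; it may be infinite. Algorithms are not required to depend measurably on
  the weights. When they do, the outer integral is the usual expectation; otherwise it is the
  lower integral, which only makes a lower bound on it stronger.\<close>

definition expected_error ::
    "'v graph \<Rightarrow> ('v set \<Rightarrow> real) measure \<Rightarrow> 'v algorithm \<Rightarrow> ennreal" where
  "expected_error F D B =
     (\<integral>\<^sup>+ w. (\<integral>\<^sup>+ M. ennreal (sum w M - sum w (min_weight_pm F w)) \<partial>measure_pmf (B F w)) \<partial>D)"

text \<open>The value of ln (1/x) on [0, 1], with the convention that it is infinite at 0 (the library's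
  real logarithm would give 0 there).\<close>

definition ln_inverse :: "real \<Rightarrow> ereal" where
  "ln_inverse x = (if x = 0 then \<infinity> else ereal (ln (1 / x)))"

end

(* Plant a matching: cut the n vertices into a left and a right half, cut both halves into blocks of
   size d = m div n, match left and right within blocks by a uniformly random block-preserving
   permutation, and give weight 0 to the planted edges and W to all others. A matching then pays W for
   each planted edge it misses. Exchanging the partners of two left vertices of a block moves the
   weights by at most 4 W in the l1 norm and preserves the distribution, so by group privacy a planted
   edge is hit with average probability at most exp(4 eps W) / d plus a delta term. With
   W = Theta(ln (m/n) / eps) a constant fraction of the planted edges is missed. If m/n is bounded
   this bound may be vacuous (d may be 2 and delta close to 1); then W = 1/4 makes the exchanged
   inputs neighboring, and comparing just two of them suffices. The assumption on delta keeps the delta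
   terms below a constant less than 1 in both cases, and the minimum is simply bounded by ln (m/n). *)

theory Submission
  imports Defs
begin

section \<open>Connected topologies with prescribed edges\<close>

text \<open>The path 0, 1, ..., n - 1 has fewer than n edges and makes every edge set containing it
  connected. It is added to \<open>H\<close>, and the union is then filled up with arbitrary pairs
  to exactly \<open>m\<close> edges.\<close>

lemma exists_connected_supergraph:
  assumes H: "H \<subseteq> {e. e \<subseteq> {..<n} \<and> card e = 2}"
    and card_H: "card H + n \<le> m" and m: "m \<le> n choose 2"
  obtains F :: "nat graph" where "verts F = {..<n}" "simple_graph F" "connected_graph F"
    "H \<subseteq> edges F" "card (edges F) = m"
proof -
  let ?C = "{e. e \<subseteq> {..<n} \<and> card e = 2}"
  let ?P = "(\<lambda>i. {i, Suc i}) ` {..<n - 1}"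
  have P: "?P \<subseteq> ?C" by auto
  have fin: "finite ?C" by (rule finite_subset[of _ "Pow {..<n}"]) auto
  have "card (H \<union> ?P) \<le> card H + card ?P" by (rule card_Un_le)
  also have "card ?P \<le> n - 1" by (rule order_trans[OF card_image_le]) auto
  finally have "card (H \<union> ?P) \<le> m" using card_H by linarith
  moreover have "card ?C = n choose 2" using n_subsets[of "{..<n}" 2] by simp
  ultimately obtain E where E: "H \<union> ?P \<subseteq> E" "E \<subseteq> ?C" "card E = m"
    using exists_subset_between[of "H \<union> ?P" m ?C] H P fin m by auto
  define R where "R = {(x, y). {x, y} \<in> E}"
  have sym: "sym R" unfolding R_def sym_def by (auto simp: insert_commute)
  have from0: "(0, k) \<in> R\<^sup>*" if "k < n" for k
    using that
  proof (induction k)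
    case (Suc k)
    have "(k, Suc k) \<in> R" using Suc.prems E(1) by (auto simp: R_def)
    then show ?case using Suc by (meson Suc_lessD rtrancl.rtrancl_into_rtrancl)
  qed simp
  have "(u, v) \<in> R\<^sup>*" if "u < n" "v < n" for u v
    using from0[OF that(1)] from0[OF that(2)] sym
    by (meson rtrancl_trans sym_rtrancl symD)
  then have "connected_graph ({..<n}, E)" by (simp add: connected_graph_def R_def)
  moreover have "simple_graph ({..<n}, E)" using E(2) by (auto simp: simple_graph_def)
  ultimately show ?thesis using that[of "({..<n}, E)"] E by auto
qed

section \<open>Group privacy\<close>

text \<open>The segment from \<open>w\<close> to \<open>w'\<close> is cut into \<open>Suc k\<close>
  pieces of l1 length at most 1. The \<delta> terms form a geometric sum with \<open>Suc k\<close>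
  summands, each bounded here by \<open>exp (\<epsilon> * Suc k) * \<delta>\<close>.\<close>

lemma group_privacy:
  fixes \<epsilon> \<delta> :: real
  assumes dp: "differentially_private \<epsilon> \<delta> F B" and "\<epsilon> \<ge> 0" "\<delta> \<ge> 0"
    and "w \<in> space (weight_space F)" "w' \<in> space (weight_space F)"
    and "(\<Sum>e\<in>edges F. \<bar>w e - w' e\<bar>) \<le> real (Suc k)"
  shows "measure_pmf.prob (B F w) Y
    \<le> exp (\<epsilon> * Suc k) * measure_pmf.prob (B F w') Y + Suc k * exp (\<epsilon> * Suc k) * \<delta>"
  using assms(4-6)
proof (induction k arbitrary: w)
  case 0
  then have "measure_pmf.prob (B F w) Y \<le> exp \<epsilon> * measure_pmf.prob (B F w') Y + \<delta>"
    using dp by (auto simp: differentially_private_def neighboring_def)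
  moreover have "1 * \<delta> \<le> exp \<epsilon> * \<delta>"
    using assms(2,3) by (intro mult_right_mono) auto
  ultimately show ?case by simp
next
  case (Suc k)
  \<comment> \<open>With k + 2 pieces, \<open>v\<close> is the end of the first one: it is a
    neighbor of \<open>w\<close>, and distance at most k + 1 to \<open>w'\<close> is left for the
    induction hypothesis.\<close>
  define t where "t = 1 / real (Suc (Suc k))"
  have t: "0 \<le> t" "t \<le> 1" by (auto simp: t_def)
  define v where "v = restrict (\<lambda>e. w e + t * (w' e - w e)) (edges F)"
  have v: "v \<in> space (weight_space F)"
    by (simp add: v_def weight_space_def space_PiM)
  let ?S = "\<Sum>e\<in>edges F. \<bar>w e - w' e\<bar>"
  have "(\<Sum>e\<in>edges F. \<bar>w e - v e\<bar>) = t * ?S"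
    unfolding v_def sum_distrib_left using t
    by (intro sum.cong) (auto simp: abs_mult abs_minus_commute)
  also have "\<dots> \<le> t * real (Suc (Suc k))" using Suc.prems t by (intro mult_left_mono) auto
  also have "\<dots> = 1" by (simp add: t_def)
  finally have near: "neighboring F w v" by (simp add: neighboring_def)
  have "(\<Sum>e\<in>edges F. \<bar>v e - w' e\<bar>) = (1 - t) * ?S"
    unfolding sum_distrib_left
  proof (intro sum.cong refl)
    fix e assume "e \<in> edges F"
    then have "v e - w' e = (1 - t) * (w e - w' e)" by (simp add: v_def algebra_simps)
    then show "\<bar>v e - w' e\<bar> = (1 - t) * \<bar>w e - w' e\<bar>" using t by (simp add: abs_mult)
  qed
  also have "\<dots> \<le> (1 - t) * real (Suc (Suc k))"
    using Suc.prems t by (intro mult_left_mono) auto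
  also have "\<dots> = real (Suc k)" by (simp add: t_def field_simps)
  finally have IH: "measure_pmf.prob (B F v) Y
    \<le> exp (\<epsilon> * Suc k) * measure_pmf.prob (B F w') Y + Suc k * exp (\<epsilon> * Suc k) * \<delta>"
    using Suc.IH[of v] v Suc.prems by blast
  have e: "exp (\<epsilon> * Suc (Suc k)) = exp \<epsilon> * exp (\<epsilon> * Suc k)"
    by (simp add: exp_add[symmetric] algebra_simps)
  have "measure_pmf.prob (B F w) Y \<le> exp \<epsilon> * measure_pmf.prob (B F v) Y + \<delta>"
    using dp near v Suc.prems by (simp add: differentially_private_def)
  also have "\<dots> \<le> exp \<epsilon> * (exp (\<epsilon> * Suc k) * measure_pmf.prob (B F w') Y
      + Suc k * exp (\<epsilon> * Suc k) * \<delta>) + \<delta>"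
    using IH by (intro add_mono mult_left_mono) auto
  also have "\<dots> = exp (\<epsilon> * Suc (Suc k)) * measure_pmf.prob (B F w') Y
      + Suc k * exp (\<epsilon> * Suc (Suc k)) * \<delta> + 1 * \<delta>"
    unfolding e by (simp only: algebra_simps)
  also have "1 * \<delta> \<le> exp (\<epsilon> * Suc (Suc k)) * \<delta>"
    using assms(2,3) by (intro mult_right_mono) auto
  finally show ?case by (simp add: algebra_simps)
qed

section \<open>Planted block-preserving matchings\<close>

lemma div_eq_iff_less:
  fixes d :: nat
  assumes "0 < d"
  shows "j div d = q \<longleftrightarrow> q * d \<le> j \<and> j < q * d + d"
  using assms by (metis div_nat_eqI dividend_less_div_times div_times_less_eq_dividend mult.commute
      mult_Suc_right add.commute)

text \<open>Left vertices are the \<open>i < h\<close>, the right vertices are \<open>h + j\<close>,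
  and \<open>i div d\<close> is the number of the block of \<open>i\<close>. \<open>F\<close>
  contains all left-right edges within blocks and may contain others, which any output may
  use.\<close>

locale planted_matching =
  fixes h d :: nat and F :: "nat graph"
  assumes verts_F: "verts F = {..<2 * h}"
    and simple_F: "simple_graph F"
    and block_edge: "\<And>i j. i < h \<Longrightarrow> j < h \<Longrightarrow> i div d = j div d \<Longrightarrow> {i, h + j} \<in> edges F"
    and d_pos: "0 < d"
begin

definition block_perms :: "(nat \<Rightarrow> nat) set" where
  "block_perms = {\<pi>. \<pi> permutes {..<h} \<and> (\<forall>i<h. \<pi> i div d = i div d)}"

definition block :: "nat \<Rightarrow> nat set" where
  "block i = {j. j < h \<and> j div d = i div d}"

definition planted_edge :: "(nat \<Rightarrow> nat) \<Rightarrow> nat \<Rightarrow> nat set" where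
  "planted_edge \<pi> i = {i, h + \<pi> i}"

definition planted :: "(nat \<Rightarrow> nat) \<Rightarrow> nat set set" where
  "planted \<pi> = planted_edge \<pi> ` {..<h}"

text \<open>The restriction makes the vector an element of the carrier of
  \<open>weight_space F\<close>.\<close>

definition weights :: "real \<Rightarrow> (nat \<Rightarrow> nat) \<Rightarrow> nat set \<Rightarrow> real" where
  "weights W \<pi> = restrict (\<lambda>e. if e \<in> planted \<pi> then 0 else W) (edges F)"

definition weight_distribution :: "real \<Rightarrow> (nat set \<Rightarrow> real) measure" where
  "weight_distribution W =
     distr (measure_pmf (pmf_of_set block_perms)) (weight_space F) (weights W)"

lemma finite_edges: "finite (edges F)"
  using simple_F by (auto simp: simple_graph_def intro!: finite_subset[of "edges F" "Pow (verts F)"])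

lemma finite_block_perms: "finite block_perms"
  unfolding block_perms_def by (rule finite_subset[OF _ finite_permutations[of "{..<h}"]]) auto

lemma id_block_perms: "id \<in> block_perms"
  by (auto simp: block_perms_def permutes_id)

lemma card_block_perms: "card block_perms > 0"
  using finite_block_perms id_block_perms by (auto simp: card_gt_0_iff)

lemma block_perms_less: "\<pi> \<in> block_perms \<Longrightarrow> i < h \<Longrightarrow> \<pi> i < h"
  using permutes_in_image[of \<pi> "{..<h}" i] by (auto simp: block_perms_def)

lemma block_perms_eq_iff: "\<pi> \<in> block_perms \<Longrightarrow> \<pi> i = \<pi> j \<longleftrightarrow> i = j"
  using permutes_inj[of \<pi> "{..<h}"] by (auto simp: block_perms_def dest: injD)

lemma block_perms_swap:
  assumes "\<pi> \<in> block_perms" "i < h" "u \<in> block i"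
  shows "\<pi> \<circ> Transposition.transpose i u \<in> block_perms"
  using assms unfolding block_perms_def block_def
  by (auto intro!: permutes_compose permutes_swap_id simp: Transposition.transpose_def)

text \<open>The map is its own inverse. Exchanging two partners thus preserves the uniform
  distribution on \<open>block_perms\<close>.\<close>

lemma bij_block_perms_swap:
  assumes "i < h" "u \<in> block i"
  shows "bij_betw (\<lambda>\<pi>. \<pi> \<circ> Transposition.transpose i u) block_perms block_perms"
  using block_perms_swap assms
  by (intro bij_betw_byWitness[where f' = "\<lambda>\<pi>. \<pi> \<circ> Transposition.transpose i u"])
     (auto simp: comp_assoc)

text \<open>The bound on \<open>i\<close> selects the complete blocks; the last block is smaller
  when \<open>d\<close> does not divide \<open>h\<close>.\<close>

lemma card_block:
  assumes "i < h div d * d"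
  shows "card (block i) = d"
proof -
  have "i div d < h div d" using assms d_pos by (simp add: less_mult_imp_div_less)
  then have "Suc (i div d) * d \<le> h div d * d" by (intro mult_right_mono) auto
  also have "\<dots> \<le> h" by simp
  finally have "block i = {i div d * d ..< i div d * d + d}"
    using d_pos by (auto simp: block_def div_eq_iff_less)
  then show ?thesis by simp
qed

lemma planted_edge_eq_iff:
  assumes "\<pi> \<in> block_perms" "\<rho> \<in> block_perms" "i < h" "j < h"
  shows "planted_edge \<pi> i = planted_edge \<rho> j \<longleftrightarrow> i = j \<and> \<pi> i = \<rho> j"
  using assms block_perms_less[of \<pi> i] block_perms_less[of \<rho> j]
  by (auto simp: planted_edge_def doubleton_eq_iff)

lemma planted_edge_in: "\<pi> \<in> block_perms \<Longrightarrow> i < h \<Longrightarrow> planted_edge \<pi> i \<in> edges F"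
  unfolding planted_edge_def using block_perms_less
  by (intro block_edge) (auto simp: block_perms_def)

lemma perfect_matching_planted:
  assumes \<pi>: "\<pi> \<in> block_perms"
  shows "perfect_matching F (planted \<pi>)"
  unfolding perfect_matching_def
proof (intro conjI)
  show "planted \<pi> \<subseteq> edges F" using planted_edge_in \<pi> by (auto simp: planted_def)
  show "disjoint (planted \<pi>)"
  proof (rule disjointI)
    fix e f assume "e \<in> planted \<pi>" "f \<in> planted \<pi>" "e \<noteq> f"
    then obtain i j where "i < h" "j < h" "e = planted_edge \<pi> i" "f = planted_edge \<pi> j" "i \<noteq> j"
      by (auto simp: planted_def)
    then show "e \<inter> f = {}" using \<pi> by (auto simp: planted_edge_def block_perms_eq_iff)
  qed
  have img: "\<pi> ` {..<h} = {..<h}" using \<pi> by (simp add: block_perms_def permutes_image)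
  have "\<Union>(planted \<pi>) = {..<h} \<union> (+) h ` (\<pi> ` {..<h})"
    by (auto simp: planted_def planted_edge_def)
  also have "\<dots> = {..<2 * h}"
    unfolding img
  proof (intro set_eqI iffI)
    fix x assume "x \<in> {..<2 * h}"
    then show "x \<in> {..<h} \<union> (+) h ` {..<h}"
      by (cases "x < h") (auto intro!: image_eqI[where x = "x - h"])
  qed auto
  finally show "\<Union>(planted \<pi>) = verts F" by (simp add: verts_F)
qed

lemma card_perfect_matching:
  assumes "perfect_matching F M"
  shows "card M = h"
proof -
  have M: "M \<subseteq> edges F" "disjoint M" "\<Union>M = {..<2 * h}"
    using assms by (auto simp: perfect_matching_def verts_F)
  have two: "card e = 2 \<and> finite e" if "e \<in> M" for e
  proof -
    have "card e = 2" using that M(1) simple_F by (auto simp: simple_graph_def)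
    then show ?thesis by (simp add: card_ge_0_finite)
  qed
  have "2 * h = card (\<Union>M)" by (simp add: M(3))
  also have "\<dots> = sum card M" using M(2) two by (intro card_Union_disjoint) auto
  also have "\<dots> = 2 * card M" using two by simp
  finally show ?thesis by simp
qed

section \<open>Random planted weights and the error of an output\<close>

lemma weights_space: "weights W \<pi> \<in> space (weight_space F)"
  by (simp add: weights_def weight_space_def space_PiM)

lemma prob_space_weight_distribution: "prob_space (weight_distribution W)"
  unfolding weight_distribution_def
  by (intro prob_space.prob_space_distr prob_space_measure_pmf measurable_measure_pmf)
     (auto simp: weights_space)

text \<open>The function \<open>f\<close> is arbitrary, since algorithms may depend on the weights
  in a non-measurable way. It is bounded below by the function that agrees with it on the finitely
  many planted weight vectors and is 0 elsewhere; this one is measurable because singletons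
  are.\<close>

lemma nn_integral_weight_distribution:
  "(\<Sum>\<pi>\<in>block_perms. f (weights W \<pi>)) / of_nat (card block_perms)
     \<le> (\<integral>\<^sup>+ w. f w \<partial>weight_distribution W)"
proof -
  let ?A = "weights W ` block_perms"
  let ?g = "\<lambda>w. \<Sum>v\<in>?A. f v * indicator {v} w"
  have fin: "finite ?A" using finite_block_perms by simp
  have g: "?g w = f w * indicator ?A w" for w
    using fin by (simp add: indicator_def sum.If_cases if_distrib cong: if_cong)
  have sing: "{v} \<in> sets (weight_space F)" if "v \<in> ?A" for v
  proof -
    have v: "v \<in> extensional (edges F)" using that by (auto simp: weights_def)
    have "{v} = Pi\<^sub>E (edges F) (\<lambda>e. {v e})"
      using v by (simp add: PiE_singleton)
    then show ?thesis unfolding weight_space_def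
      using finite_edges by (auto intro!: sets_PiM_I_finite)
  qed
  have meas: "?g \<in> borel_measurable (weight_space F)"
    using sing by (intro borel_measurable_sum borel_measurable_times_ennreal
        borel_measurable_const borel_measurable_indicator) auto
  have "(\<integral>\<^sup>+ w. ?g w \<partial>weight_distribution W)
      = (\<integral>\<^sup>+ \<pi>. ?g (weights W \<pi>) \<partial>measure_pmf (pmf_of_set block_perms))"
    unfolding weight_distribution_def
    using meas by (intro nn_integral_distr) (auto simp: weights_space)
  also have "\<dots> = (\<Sum>\<pi>\<in>block_perms. ?g (weights W \<pi>)) / of_nat (card block_perms)"
    using finite_block_perms id_block_perms
    by (subst nn_integral_pmf_of_set) auto
  also have "(\<Sum>\<pi>\<in>block_perms. ?g (weights W \<pi>)) = (\<Sum>\<pi>\<in>block_perms. f (weights W \<pi>))"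
    unfolding g by (intro sum.cong) auto
  finally have "(\<Sum>\<pi>\<in>block_perms. f (weights W \<pi>)) / of_nat (card block_perms)
      = (\<integral>\<^sup>+ w. ?g w \<partial>weight_distribution W)" by simp
  also have "\<dots> \<le> (\<integral>\<^sup>+ w. f w \<partial>weight_distribution W)"
    unfolding g by (intro nn_integral_mono) (auto simp: indicator_def)
  finally show ?thesis .
qed

lemma sum_weights:
  assumes "M \<subseteq> edges F"
  shows "sum (weights W \<pi>) M = W * real (card (M - planted \<pi>))"
proof -
  have fin: "finite M" using assms finite_edges by (rule finite_subset)
  have "sum (weights W \<pi>) M = (\<Sum>e\<in>M. if e \<in> planted \<pi> then 0 else W)"
    using assms by (intro sum.cong) (auto simp: weights_def)
  also have "\<dots> = (\<Sum>e\<in>M - planted \<pi>. W)"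
    using fin by (intro sum.mono_neutral_cong_right) auto
  finally show ?thesis by simp
qed

text \<open>The planted matching has weight 0, so the optimum is at most 0. \<open>M\<close> pays
  \<open>W\<close> for each edge that is not planted, and since both matchings have \<open>h\<close>
  edges, there are as many of these as planted edges missing from \<open>M\<close>.\<close>

lemma error_ge:
  assumes \<pi>: "\<pi> \<in> block_perms" and M: "perfect_matching F M"
  shows "(\<Sum>i<h. W * of_bool (planted_edge \<pi> i \<notin> M))
    \<le> sum (weights W \<pi>) M - sum (weights W \<pi>) (min_weight_pm F (weights W \<pi>))"
proof -
  let ?P = "{M. perfect_matching F M}"
  have fin: "finite ?P"
    using finite_edges
    by (intro finite_subset[of ?P "Pow (edges F)"]) (auto simp: perfect_matching_def)
  have P: "planted \<pi> \<in> ?P" using perfect_matching_planted \<pi> by simp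
  then have "sum (weights W \<pi>) (min_weight_pm F (weights W \<pi>)) \<le> sum (weights W \<pi>) (planted \<pi>)"
    unfolding min_weight_pm_def using fin by (intro arg_min_least) auto
  also have "\<dots> = 0" using P by (subst sum_weights) (auto simp: perfect_matching_def)
  finally have opt: "sum (weights W \<pi>) (min_weight_pm F (weights W \<pi>)) \<le> 0" .
  have "finite M" using M finite_edges by (auto simp: perfect_matching_def intro: finite_subset)
  moreover have "finite (planted \<pi>)" by (simp add: planted_def)
  moreover have "card M = card (planted \<pi>)" using card_perfect_matching M P by simp
  ultimately have card: "card (M - planted \<pi>) = card (planted \<pi> - M)"
    by (simp add: card_Diff_subset_Int Int_commute)
  have "inj_on (planted_edge \<pi>) {..<h}"
    using planted_edge_eq_iff[OF \<pi> \<pi>] by (auto intro!: inj_onI)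
  moreover have "planted \<pi> - M = planted_edge \<pi> ` {i. i < h \<and> planted_edge \<pi> i \<notin> M}"
    by (auto simp: planted_def)
  ultimately have "card (planted \<pi> - M) = card {i. i < h \<and> planted_edge \<pi> i \<notin> M}"
    by (simp add: card_image inj_on_def)
  also have "real \<dots> = (\<Sum>i<h. of_bool (planted_edge \<pi> i \<notin> M))"
    by (simp add: of_bool_def sum.If_cases Int_def lessThan_def)
  finally have "(\<Sum>i<h. W * of_bool (planted_edge \<pi> i \<notin> M)) = sum (weights W \<pi>) M"
    using M by (simp add: sum_weights card perfect_matching_def sum_distrib_left)
  then show ?thesis using opt by linarith
qed

text \<open>Linearity of expectation reduces the error to the average probability of missing a
  single planted edge. Only vertices in complete blocks are counted; the others contribute
  nonnegative terms.\<close>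

lemma expected_error_ge:
  fixes W q :: real
  assumes B: "outputs_perfect_matching F B" and W: "0 \<le> W"
    and q: "0 \<le> q" and
    miss: "\<And>i. i < h div d * d \<Longrightarrow>
      q * card block_perms \<le> (\<Sum>\<pi>\<in>block_perms.
        measure_pmf.prob (B F (weights W \<pi>)) {M. planted_edge \<pi> i \<notin> M})"
  shows "ennreal (W * (real (h div d * d) * q)) \<le> expected_error F (weight_distribution W) B"
proof -
  let ?p = "\<lambda>\<pi> i. measure_pmf.prob (B F (weights W \<pi>)) {M. planted_edge \<pi> i \<notin> M}"
  let ?err = "\<lambda>w. \<integral>\<^sup>+ M. ennreal (sum w M - sum w (min_weight_pm F w)) \<partial>measure_pmf (B F w)"
  have err: "ennreal (W * (\<Sum>i<h. ?p \<pi> i)) \<le> ?err (weights W \<pi>)" if \<pi>: "\<pi> \<in> block_perms" for \<pi>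
  proof -
    let ?Q = "measure_pmf (B F (weights W \<pi>))"
    have "ennreal (W * (\<Sum>i<h. ?p \<pi> i)) = (\<Sum>i<h. ennreal W * emeasure ?Q {M. planted_edge \<pi> i \<notin> M})"
      using W by (simp add: sum_distrib_left measure_pmf.emeasure_eq_measure
          ennreal_mult[symmetric] sum_ennreal)
    also have "\<dots> = (\<integral>\<^sup>+ M. (\<Sum>i<h. ennreal W * indicator {M. planted_edge \<pi> i \<notin> M} M) \<partial>?Q)"
      by (subst nn_integral_sum) (auto simp: nn_integral_cmult)
    also have "\<dots> = (\<integral>\<^sup>+ M. ennreal (\<Sum>i<h. W * of_bool (planted_edge \<pi> i \<notin> M)) \<partial>?Q)"
      using W by (intro nn_integral_cong, subst sum_ennreal[symmetric])
        (auto simp del: sum_ennreal simp: indicator_def ennreal_mult of_bool_def intro!: sum.cong)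
    also have "\<dots> \<le> ?err (weights W \<pi>)"
    proof (rule nn_integral_mono_AE)
      show "AE M in ?Q. ennreal (\<Sum>i<h. W * of_bool (planted_edge \<pi> i \<notin> M))
        \<le> ennreal (sum (weights W \<pi>) M - sum (weights W \<pi>) (min_weight_pm F (weights W \<pi>)))"
        using B weights_space[of W \<pi>] error_ge[OF \<pi>]
        by (auto simp: AE_measure_pmf_iff outputs_perfect_matching_def intro!: ennreal_leI)
    qed
    finally show ?thesis .
  qed
  have hd: "h div d * d \<le> h" by simp
  have "real (h div d * d) * q * card block_perms = (\<Sum>i<h div d * d. q * card block_perms)"
    by simp
  also have "\<dots> \<le> (\<Sum>i<h div d * d. \<Sum>\<pi>\<in>block_perms. ?p \<pi> i)"
    using miss by (intro sum_mono) auto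
  also have "\<dots> \<le> (\<Sum>i<h. \<Sum>\<pi>\<in>block_perms. ?p \<pi> i)"
    using hd by (intro sum_mono2) (auto intro!: sum_nonneg simp del: div_times_less_eq_dividend)
  also have "\<dots> = (\<Sum>\<pi>\<in>block_perms. \<Sum>i<h. ?p \<pi> i)" by (rule sum.swap)
  finally have "W * (real (h div d * d) * q * card block_perms)
      \<le> W * (\<Sum>\<pi>\<in>block_perms. \<Sum>i<h. ?p \<pi> i)"
    using W by (rule mult_left_mono)
  then have "W * (real (h div d * d) * q)
      \<le> (\<Sum>\<pi>\<in>block_perms. W * (\<Sum>i<h. ?p \<pi> i)) / card block_perms"
    using card_block_perms by (simp add: pos_le_divide_eq sum_distrib_left mult_ac)
  then have "ennreal (W * (real (h div d * d) * q))
      \<le> ennreal ((\<Sum>\<pi>\<in>block_perms. W * (\<Sum>i<h. ?p \<pi> i)) / card block_perms)"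
    by (rule ennreal_leI)
  also have "\<dots> = (\<Sum>\<pi>\<in>block_perms. ennreal (W * (\<Sum>i<h. ?p \<pi> i))) / of_nat (card block_perms)"
    using W card_block_perms
    by (simp add: sum_ennreal sum_nonneg divide_ennreal ennreal_of_nat_eq_real_of_nat)
  also have "\<dots> \<le> (\<Sum>\<pi>\<in>block_perms. ?err (weights W \<pi>)) / of_nat (card block_perms)"
    using err by (intro divide_right_mono_ennreal sum_mono) auto
  also have "\<dots> \<le> expected_error F (weight_distribution W) B"
    unfolding expected_error_def by (rule nn_integral_weight_distribution)
  finally show ?thesis .
qed

section \<open>Exchanging two partners and missing a planted edge\<close>

text \<open>Only the edges between \<open>i\<close>, \<open>u\<close> and their two partners can
  enter or leave the planted matching, and each of them changes its weight by at most
  \<open>W\<close>.\<close>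

lemma weights_swap_distance:
  assumes "0 \<le> W" "\<pi> \<in> block_perms" "i < h" "u \<in> block i"
  defines "\<rho> \<equiv> \<pi> \<circ> Transposition.transpose i u"
  shows "(\<Sum>e\<in>edges F. \<bar>weights W \<pi> e - weights W \<rho> e\<bar>) \<le> 4 * W"
proof -
  let ?T = "{{i, h + \<pi> i}, {u, h + \<pi> u}, {i, h + \<pi> u}, {u, h + \<pi> i}}"
  have same: "planted_edge \<pi> j = planted_edge \<rho> j" if "j \<noteq> i" "j \<noteq> u" for j
    using that by (simp add: planted_edge_def \<rho>_def)
  have diff: "e \<in> planted \<pi> \<longleftrightarrow> e \<in> planted \<rho>" if "e \<notin> ?T" for e
  proof -
    have "e = planted_edge \<pi> j \<longleftrightarrow> e = planted_edge \<rho> j" if "j < h" for j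
      using same[of j] \<open>e \<notin> ?T\<close> by (cases "j = i"; cases "j = u") (auto simp: planted_edge_def \<rho>_def)
    then show ?thesis by (auto simp: planted_def image_iff)
  qed
  have "(\<Sum>e\<in>edges F. \<bar>weights W \<pi> e - weights W \<rho> e\<bar>) \<le> (\<Sum>e\<in>edges F. W * of_bool (e \<in> ?T))"
    using assms(1) diff by (intro sum_mono) (auto simp: weights_def simp del: insert_iff)
  also have "\<dots> = W * card (edges F \<inter> ?T)"
    using finite_edges by (simp add: sum_distrib_left[symmetric] of_bool_def sum.If_cases Int_def del: insert_iff)
  also have "card (edges F \<inter> ?T) \<le> card ?T" by (intro card_mono) auto
  \<comment> \<open>The four edges coincide if \<open>u = i\<close>, so 4 is only an upper
    bound.\<close>
  also have "card ?T \<le> 4" using card_length[of "[{i, h + \<pi> i}, {u, h + \<pi> u}, {i, h + \<pi> u}, {u, h + \<pi> i}]"] by simp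
  finally show ?thesis using assms(1) by (simp add: mult.commute mult_left_mono)
qed

lemma sum_swap:
  fixes f :: "(nat \<Rightarrow> nat) \<Rightarrow> real"
  assumes "i < h" "u \<in> block i"
  shows "(\<Sum>\<pi>\<in>block_perms. f (\<pi> \<circ> Transposition.transpose i u)) = (\<Sum>\<pi>\<in>block_perms. f \<pi>)"
  using bij_block_perms_swap[OF assms] by (rule sum.reindex_bij_betw)

lemma planted_edge_swap: "planted_edge (\<pi> \<circ> Transposition.transpose i u) i = {i, h + \<pi> u}"
  by (simp add: planted_edge_def)

text \<open>\<open>K\<close> and \<open>\<Delta>\<close> stand for the multiplicative and additive
  privacy loss between inputs that differ by one exchange. They are kept abstract to serve both a
  single privacy step and group privacy.\<close>

context
  fixes B :: "nat algorithm" and W K \<Delta> :: real and i :: nat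
  assumes B: "outputs_perfect_matching F B" and W: "0 \<le> W" and K: "0 \<le> K"
    and close: "\<And>w w' Y. w \<in> space (weight_space F) \<Longrightarrow> w' \<in> space (weight_space F) \<Longrightarrow>
      (\<Sum>e\<in>edges F. \<bar>w e - w' e\<bar>) \<le> 4 * W \<Longrightarrow>
      measure_pmf.prob (B F w) Y \<le> K * measure_pmf.prob (B F w') Y + \<Delta>"
    and i: "i < h div d * d"
begin

abbreviation "pr \<pi> Y \<equiv> measure_pmf.prob (B F (weights W \<pi>)) Y"
abbreviation "miss \<pi> \<equiv> pr \<pi> {M. planted_edge \<pi> i \<notin> M}"

lemma i_less: "i < h"
  using i by (meson div_times_less_eq_dividend less_le_trans)

lemma swap_close:
  assumes "\<pi> \<in> block_perms" "u \<in> block i"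
  shows "pr \<pi> Y \<le> K * pr (\<pi> \<circ> Transposition.transpose i u) Y + \<Delta>"
    and "pr (\<pi> \<circ> Transposition.transpose i u) Y \<le> K * pr \<pi> Y + \<Delta>"
  using weights_swap_distance[OF W assms(1) i_less assms(2)]
  by (auto intro!: close weights_space simp: abs_minus_commute)

lemma hit_eq: "pr \<pi> {M. e \<in> M} = 1 - pr \<pi> {M. e \<notin> M}"
proof -
  have "{M. e \<in> M} = UNIV - {M. e \<notin> M}" by auto
  then show ?thesis using measure_pmf.prob_compl[of "{M. e \<notin> M}" "B F (weights W \<pi>)"] by simp
qed

text \<open>The edges all contain \<open>i\<close> and are distinct as \<pi> is injective, so a
  matching contains at most one of them and the events are disjoint.\<close>

lemma sum_hits_le:
  assumes \<pi>: "\<pi> \<in> block_perms"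
  shows "(\<Sum>u\<in>block i. pr \<pi> {M. {i, h + \<pi> u} \<in> M}) \<le> 1"
proof -
  let ?Q = "B F (weights W \<pi>)"
  \<comment> \<open>Only outputs in the support are known to be matchings.\<close>
  let ?A = "\<lambda>u. {M. {i, h + \<pi> u} \<in> M} \<inter> set_pmf ?Q"
  have "disjoint_family_on ?A (block i)"
  proof (unfold disjoint_family_on_def, intro ballI impI, rule ccontr)
    fix u v assume uv: "u \<in> block i" "v \<in> block i" "u \<noteq> v" "?A u \<inter> ?A v \<noteq> {}"
    then obtain M where M: "{i, h + \<pi> u} \<in> M" "{i, h + \<pi> v} \<in> M" "M \<in> set_pmf ?Q" by auto
    then have "disjoint M"
      using B weights_space by (auto simp: outputs_perfect_matching_def perfect_matching_def)
    then have "{i, h + \<pi> u} = {i, h + \<pi> v}" using M(1,2) by (auto dest: disjointD)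
    then have "\<pi> u = \<pi> v" using i_less by (auto simp: doubleton_eq_iff)
    then show False using uv(3) \<pi> by (simp add: block_perms_eq_iff)
  qed
  then have "(\<Sum>u\<in>block i. measure_pmf.prob ?Q (?A u)) = measure_pmf.prob ?Q (\<Union>u\<in>block i. ?A u)"
    by (intro measure_pmf.finite_measure_finite_Union[symmetric]) (auto simp: block_def)
  also have "\<dots> \<le> 1" by (rule measure_pmf.prob_le_1)
  finally show ?thesis by (simp add: measure_Int_set_pmf)
qed

text \<open>For a fixed input the output contains at most one of the edges from \<^term>\<open>i\<close> to its
  block, and swapping makes each of them the planted edge of a close input.\<close>

lemma sum_miss_ge_many:
  "(1 - K / d - \<Delta>) * card block_perms \<le> (\<Sum>\<pi>\<in>block_perms. miss \<pi>)"
proof -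
  have "(\<Sum>u\<in>block i. 1 - miss (\<pi> \<circ> Transposition.transpose i u)) \<le> K + d * \<Delta>"
    if \<pi>: "\<pi> \<in> block_perms" for \<pi>
  proof -
    have "(\<Sum>u\<in>block i. 1 - miss (\<pi> \<circ> Transposition.transpose i u))
        \<le> (\<Sum>u\<in>block i. K * pr \<pi> {M. {i, h + \<pi> u} \<in> M} + \<Delta>)"
    proof (rule sum_mono)
      fix u assume u: "u \<in> block i"
      show "1 - miss (\<pi> \<circ> Transposition.transpose i u) \<le> K * pr \<pi> {M. {i, h + \<pi> u} \<in> M} + \<Delta>"
        using swap_close(2)[OF \<pi> u] unfolding hit_eq[symmetric] planted_edge_swap .
    qed
    also have "\<dots> = K * (\<Sum>u\<in>block i. pr \<pi> {M. {i, h + \<pi> u} \<in> M}) + d * \<Delta>"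
      using card_block[OF i] by (simp add: sum.distrib sum_distrib_left)
    also have "\<dots> \<le> K * 1 + d * \<Delta>"
      using sum_hits_le[OF \<pi>] K by (intro add_mono mult_left_mono) auto
    finally show ?thesis by simp
  qed
  then have "(\<Sum>\<pi>\<in>block_perms. \<Sum>u\<in>block i. 1 - miss (\<pi> \<circ> Transposition.transpose i u))
      \<le> (\<Sum>\<pi>\<in>block_perms. K + d * \<Delta>)"
    by (rule sum_mono)
  also have "(\<Sum>\<pi>\<in>block_perms. \<Sum>u\<in>block i. 1 - miss (\<pi> \<circ> Transposition.transpose i u))
      = (\<Sum>u\<in>block i. \<Sum>\<pi>\<in>block_perms. 1 - miss (\<pi> \<circ> Transposition.transpose i u))"
    by (rule sum.swap)
  \<comment> \<open>For each \<open>u\<close> the exchange only permutes the inputs, so all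
    \<open>d\<close> inner sums equal the sum without the exchange.\<close>
  also have "\<dots> = (\<Sum>u\<in>block i. \<Sum>\<pi>\<in>block_perms. 1 - miss \<pi>)"
    by (intro sum.cong refl sum_swap[where f = "\<lambda>\<pi>. 1 - miss \<pi>"] i_less)
  also have "\<dots> = d * (card block_perms - (\<Sum>\<pi>\<in>block_perms. miss \<pi>))"
    using card_block[OF i] by (simp add: sum_subtractf)
  finally have "card block_perms - (\<Sum>\<pi>\<in>block_perms. miss \<pi>) \<le> card block_perms * (K + d * \<Delta>) / d"
    using d_pos by (simp add: pos_le_divide_eq mult.commute)
  also have "\<dots> = card block_perms * (K / d + \<Delta>)"
    using d_pos by (simp add: field_simps)
  finally show ?thesis by (simp add: algebra_simps)
qed

text \<open>Take a second vertex \<open>u\<close> of the block. The planted edges at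
  \<open>i\<close> before and after the exchange share \<open>i\<close>, so no output contains both:
  hitting the first means missing the second, and by closeness the second is then also missed on the
  exchanged input, where it is planted. This stays useful when \<open>K / d\<close> exceeds
  1.\<close>

lemma sum_miss_ge_two:
  assumes d: "2 \<le> d"
  shows "(1 - \<Delta>) / (1 + K) * card block_perms \<le> (\<Sum>\<pi>\<in>block_perms. miss \<pi>)"
proof -
  have "\<not> block i \<subseteq> {i}"
    using card_block[OF i] d card_mono[of "{i}" "block i"] by auto
  then obtain u where u: "u \<in> block i" "u \<noteq> i" by auto
  have "1 - \<Delta> \<le> miss \<pi> + K * miss (\<pi> \<circ> Transposition.transpose i u)"
    if \<pi>: "\<pi> \<in> block_perms" for \<pi>
  proof -
    have "AE M in measure_pmf (B F (weights W \<pi>)).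
        planted_edge \<pi> i \<in> M \<longrightarrow> {i, h + \<pi> u} \<notin> M"
    proof (unfold AE_measure_pmf_iff, intro ballI impI notI)
      fix M assume M: "M \<in> set_pmf (B F (weights W \<pi>))" "planted_edge \<pi> i \<in> M" "{i, h + \<pi> u} \<in> M"
      then have "disjoint M"
        using B weights_space by (auto simp: outputs_perfect_matching_def perfect_matching_def)
      then have "{i, h + \<pi> i} = {i, h + \<pi> u}"
        using M(2,3) unfolding planted_edge_def by (auto dest: disjointD)
      then have "\<pi> i = \<pi> u" using i_less by (auto simp: doubleton_eq_iff)
      then show False using u(2) \<pi> by (simp add: block_perms_eq_iff)
    qed
    then have "pr \<pi> {M. planted_edge \<pi> i \<in> M} \<le> pr \<pi> {M. {i, h + \<pi> u} \<notin> M}"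
      by (intro measure_pmf.finite_measure_mono_AE) auto
    also have "\<dots> \<le> K * miss (\<pi> \<circ> Transposition.transpose i u) + \<Delta>"
      using swap_close(1)[OF \<pi> u(1)] unfolding planted_edge_swap .
    finally show ?thesis by (simp add: hit_eq)
  qed
  then have "(\<Sum>\<pi>\<in>block_perms. 1 - \<Delta>)
      \<le> (\<Sum>\<pi>\<in>block_perms. miss \<pi> + K * miss (\<pi> \<circ> Transposition.transpose i u))"
    by (rule sum_mono)
  also have "\<dots> = (\<Sum>\<pi>\<in>block_perms. miss \<pi>)
      + K * (\<Sum>\<pi>\<in>block_perms. miss (\<pi> \<circ> Transposition.transpose i u))"
    by (simp add: sum.distrib sum_distrib_left)
  also have "\<dots> = (1 + K) * (\<Sum>\<pi>\<in>block_perms. miss \<pi>)"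
    using sum_swap[OF i_less u(1), of miss] by (simp add: algebra_simps)
  finally show ?thesis using K by (simp add: pos_divide_le_eq mult_ac)
qed

end

section \<open>Expected error of private algorithms\<close>

text \<open>At scale 1/4 an exchange moves the weights by at most 1, so the privacy condition
  applies directly with \<open>K\<close> equal to \<open>exp \<epsilon>\<close> and
  \<open>\<Delta>\<close> equal to \<delta>.\<close>

lemma expected_error_ge_few_choices:
  fixes \<epsilon> \<delta> :: real
  assumes dp: "differentially_private \<epsilon> \<delta> F B" and B: "outputs_perfect_matching F B"
    and "\<delta> \<le> 1" "2 \<le> d"
  shows "ennreal (1 / 4 * (real (h div d * d) * ((1 - \<delta>) / (1 + exp \<epsilon>))))
    \<le> expected_error F (weight_distribution (1 / 4)) B"
proof (rule expected_error_ge[OF B])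
  fix i assume "i < h div d * d"
  then show "(1 - \<delta>) / (1 + exp \<epsilon>) * card block_perms \<le> (\<Sum>\<pi>\<in>block_perms.
      measure_pmf.prob (B F (weights (1 / 4) \<pi>)) {M. planted_edge \<pi> i \<notin> M})"
    using dp \<open>2 \<le> d\<close>
    by (intro sum_miss_ge_two[OF B])
       (auto simp: differentially_private_def neighboring_def)
qed (use assms in auto)

text \<open>An exchange costs at most \<open>Suc k\<close> privacy steps, and group privacy supplies
  \<open>K\<close> and \<open>\<Delta>\<close> for the bound that uses all \<open>d\<close>
  choices.\<close>

lemma expected_error_ge_many_choices:
  fixes \<epsilon> \<delta> W q :: real
  assumes dp: "differentially_private \<epsilon> \<delta> F B" and B: "outputs_perfect_matching F B"
    and "0 \<le> \<epsilon>" "0 \<le> \<delta>" "0 \<le> W" and k: "4 * W \<le> real (Suc k)"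
    and "0 \<le> q" and q: "q \<le> 1 - exp (\<epsilon> * Suc k) / d - Suc k * exp (\<epsilon> * Suc k) * \<delta>"
  shows "ennreal (W * (real (h div d * d) * q)) \<le> expected_error F (weight_distribution W) B"
proof (rule expected_error_ge[OF B])
  fix i assume i: "i < h div d * d"
  have "q * card block_perms
      \<le> (1 - exp (\<epsilon> * Suc k) / d - Suc k * exp (\<epsilon> * Suc k) * \<delta>) * card block_perms"
    using q by (intro mult_right_mono) auto
  also have "\<dots> \<le> (\<Sum>\<pi>\<in>block_perms.
      measure_pmf.prob (B F (weights W \<pi>)) {M. planted_edge \<pi> i \<notin> M})"
    using i k assms by (intro sum_miss_ge_many[OF B] group_privacy[OF dp]) auto
  finally show "q * card block_perms \<le> (\<Sum>\<pi>\<in>block_perms.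
      measure_pmf.prob (B F (weights W \<pi>)) {M. planted_edge \<pi> i \<notin> M})" .
qed (use assms in auto)

end

section \<open>The topology for given n and m, and its block sizes\<close>

text \<open>The blocks use at most \<open>h * d\<close> edges, which is at most m/2. As m/2 exceeds
  n, there is room for the path that connects the graph.\<close>

lemma exists_planted_matching_graph:
  assumes "even n" "2 * n < m" "m \<le> n choose 2"
  obtains F where "planted_matching (n div 2) (m div n) F" "connected_graph F"
    "verts F = {..<n}" "card (edges F) = m"
proof -
  define h d where "h = n div 2" and "d = m div n"
  have n: "n = 2 * h" using assms(1) by (simp add: h_def)
  have n0: "0 < n" using assms by (cases n) (auto simp: binomial_eq_0)
  have "2 * n div n \<le> m div n" using assms(2) by (intro div_le_mono) auto
  then have d: "2 \<le> d" using n0 by (simp add: d_def)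
  let ?A = "SIGMA i:{..<h}. {j. j < h \<and> j div d = i div d}"
  let ?H = "(\<lambda>(i, j). {i, h + j}) ` ?A"
  have "card ?H \<le> card ?A" by (intro card_image_le) auto
  also have "card ?A = (\<Sum>i<h. card {j. j < h \<and> j div d = i div d})"
    by (subst card_SigmaI) auto
  also have "\<dots> \<le> (\<Sum>i<h. d)"
  proof (rule sum_mono)
    fix i
    have "{j. j < h \<and> j div d = i div d} \<subseteq> {i div d * d ..< i div d * d + d}"
      using d by (auto simp: div_eq_iff_less)
    from card_mono[OF _ this] show "card {j. j < h \<and> j div d = i div d} \<le> d" by simp
  qed
  finally have card_H: "card ?H \<le> h * d" by simp
  have "2 * (h * d) \<le> m" using div_times_less_eq_dividend[of m n] by (simp add: n d_def mult_ac)
  then have "card ?H + n \<le> m" using card_H assms(2) by linarith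
  moreover have "?H \<subseteq> {e. e \<subseteq> {..<n} \<and> card e = 2}" by (auto simp: n card_insert_if)
  ultimately obtain F where F: "verts F = {..<n}" "simple_graph F" "connected_graph F"
    "?H \<subseteq> edges F" "card (edges F) = m"
    using exists_connected_supergraph assms(3) by blast
  have "planted_matching h d F"
  proof
    fix i j assume "i < h" "j < h" "i div d = j div d"
    then show "{i, h + j} \<in> edges F" using F(4) by (auto simp: image_subset_iff)
  qed (use F d n in auto)
  then show ?thesis using that F by (simp add: h_def d_def)
qed

text \<open>The bound on \<open>m\<close> by the number of pairs gives \<open>d \<le> h\<close>, so
  there is at least one complete block. The incomplete one is smaller than a block, hence at least
  half of the n/2 left vertices lie in complete blocks.\<close>

lemma quarter_le_blocks:
  assumes "even n" "0 < n" "m \<le> n choose 2" "n \<le> m"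
  shows "real n / 4 \<le> real (n div 2 div (m div n) * (m div n))"
proof -
  define h d where "h = n div 2" and "d = m div n"
  have n: "n = 2 * h" using assms(1) by (simp add: h_def)
  have "n * d \<le> m" by (simp add: d_def)
  also have "\<dots> \<le> n * (n - 1) div 2" using assms(3) by (simp add: choose_two)
  also have "\<dots> = h * (n - 1)" by (simp add: n)
  also have "\<dots> \<le> n * h" by (simp add: n)
  finally have "d \<le> h" using assms(2) by simp
  moreover have "0 < d" using assms by (simp add: d_def div_greater_zero_iff)
  ultimately have "1 \<le> h div d" by (simp add: div_greater_zero_iff Suc_leI)
  then have "1 * d \<le> h div d * d" by (intro mult_right_mono) auto
  moreover have "h < h div d * d + d" using \<open>0 < d\<close> by (metis dividend_less_div_times add.commute)
  ultimately have "h \<le> 2 * (h div d * d)" by linarith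
  then have "real h \<le> 2 * real (h div d * d)" by linarith
  then show ?thesis unfolding h_def[symmetric] d_def[symmetric] by (simp add: n)
qed

text \<open>Rounding down loses less than 1, which is less than half of a ratio exceeding 2.\<close>

lemma half_le_div:
  assumes "0 < n" "2 * n < m"
  shows "real m / real n / 2 \<le> real (m div n)"
proof -
  have "m < m div n * n + n" using assms(1) by (metis dividend_less_div_times add.commute)
  then have "real m < real (m div n) * real n + real n"
    by (metis of_nat_add of_nat_less_iff of_nat_mult)
  moreover have "2 * real n < real m" using assms by linarith
  ultimately show ?thesis using assms(1) by (simp add: field_simps)
qed

section \<open>Privacy loss as a function of the ratio m/n\<close>

text \<open>The choice of \<open>s\<close> makes both exponents negative:
  \<open>s \<le> 1 / 4\<close> and \<open>2 * s \<le> \<gamma> / 2\<close>.\<close>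

lemma eventually_privacy_loss_le:
  fixes \<epsilon> \<gamma> :: real
  assumes "\<epsilon> > 0" "\<gamma> > 0"
  defines "s \<equiv> min 1 \<gamma> / 4"
  shows "eventually (\<lambda>x. 2 * exp \<epsilon> * x powr (s - 1)
    + exp (2 * \<epsilon>) / \<epsilon> * x powr (2 * s - \<gamma>) \<le> 1 / 2) at_top"
proof -
  have s: "s - 1 < 0" "2 * s - \<gamma> < 0" using assms by (auto simp: s_def min_def)
  have "((\<lambda>x. 2 * exp \<epsilon> * x powr (s - 1) + exp (2 * \<epsilon>) / \<epsilon> * x powr (2 * s - \<gamma>))
      \<longlongrightarrow> 2 * exp \<epsilon> * 0 + exp (2 * \<epsilon>) / \<epsilon> * 0) at_top"
    by (intro tendsto_intros tendsto_neg_powr s filterlim_ident)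
  then have "eventually (\<lambda>x. 2 * exp \<epsilon> * x powr (s - 1)
      + exp (2 * \<epsilon>) / \<epsilon> * x powr (2 * s - \<gamma>) < 1 / 2) at_top"
    by (rule order_tendstoD) simp
  then show ?thesis by eventually_elim simp
qed

text \<open>The scale of the weights is such that the group privacy factor is a small power of
  \<^term>\<open>x\<close>, the number of choices per vertex.\<close>

lemma privacy_loss_le:
  fixes \<epsilon> \<gamma> \<delta> x s W :: real
  assumes "\<epsilon> > 0" "x \<ge> 1" "0 \<le> \<delta>" "\<delta> \<le> x powr - \<gamma>" "x / 2 \<le> real d" "0 \<le> s"
    and W: "W = s * ln x / (4 * \<epsilon>)" and k: "k = nat \<lfloor>4 * W\<rfloor>"
  shows "exp (\<epsilon> * Suc k) / d + Suc k * exp (\<epsilon> * Suc k) * \<delta>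
    \<le> 2 * exp \<epsilon> * x powr (s - 1) + exp (2 * \<epsilon>) / \<epsilon> * x powr (2 * s - \<gamma>)"
proof -
  let ?K = "exp (\<epsilon> * Suc k)"
  have W0: "0 \<le> W" using assms by simp
  \<comment> \<open>Since \<open>4 * \<epsilon> * W\<close> equals \<open>s * ln x\<close>, the
    factor for \<open>Suc k\<close> steps is at most \<open>x powr s\<close>, up to one factor
    \<open>exp \<epsilon>\<close> for the rounding.\<close>
  then have "real k \<le> 4 * W" unfolding k by simp
  then have "\<epsilon> * Suc k \<le> \<epsilon> * (4 * W + 1)" using assms(1) by (intro mult_left_mono) auto
  also have "\<dots> = \<epsilon> + s * ln x" using assms(1) by (simp add: W field_simps)
  finally have "?K \<le> exp (\<epsilon> + s * ln x)" by simp
  then have K: "?K \<le> exp \<epsilon> * x powr s" using assms(2) by (simp add: exp_add powr_def)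
  have "?K / d \<le> exp \<epsilon> * x powr s / (x / 2)"
    using K assms by (intro frac_le) auto
  also have "\<dots> = 2 * exp \<epsilon> * x powr (s - 1)" using assms(2) by (simp add: powr_diff)
  finally have 1: "?K / d \<le> 2 * exp \<epsilon> * x powr (s - 1)" .
  \<comment> \<open>The linear factor \<open>Suc k\<close> is absorbed by a second exponential;
    hence the exponent \<open>2 * s\<close> and the division by \<epsilon>.\<close>
  have "\<epsilon> * Suc k \<le> ?K" using exp_ge_add_one_self[of "\<epsilon> * Suc k"] by linarith
  then have "Suc k \<le> ?K / \<epsilon>" using assms(1) by (simp add: pos_le_divide_eq mult.commute)
  then have "Suc k * ?K * \<delta> \<le> ?K / \<epsilon> * ?K * \<delta>"
    using assms by (intro mult_right_mono) auto
  also have "\<dots> \<le> (exp \<epsilon> * x powr s) / \<epsilon> * (exp \<epsilon> * x powr s) * x powr - \<gamma>"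
    using K assms by (intro mult_mono divide_right_mono) auto
  also have "\<dots> = exp (2 * \<epsilon>) / \<epsilon> * x powr (2 * s - \<gamma>)"
  proof -
    have "exp (2 * \<epsilon>) = exp \<epsilon> * exp \<epsilon>" by (simp add: exp_add[symmetric])
    moreover have "x powr (2 * s - \<gamma>) = x powr s * x powr s * x powr - \<gamma>"
      by (simp add: powr_add[symmetric])
    ultimately show ?thesis by simp
  qed
  finally show ?thesis using 1 by linarith
qed

section \<open>Constants, and the cases of bounded and large m/n\<close>

theorem theorem4p2:
  fixes \<epsilon> \<gamma> :: real
  assumes "\<epsilon> > 0" and "\<gamma> > 0"
  shows "\<exists>c::real. c > 0 \<and>
    (\<forall>(n::nat) (m::nat) (\<delta>::real).
       even n \<and> m > 2 * n \<and> m \<le> n choose 2 \<and>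
       0 \<le> \<delta> \<and> \<delta> \<le> 1 \<and> \<delta> \<le> (real n / real m) powr \<gamma> \<longrightarrow>
       (\<exists>(F :: nat graph) D.
          simple_graph F \<and> connected_graph F \<and>
          card (verts F) = n \<and> card (edges F) = m \<and> (\<exists>M. perfect_matching F M) \<and>
          prob_space D \<and> sets D = sets (weight_space F) \<and>
          (\<forall>B. differentially_private \<epsilon> \<delta> F B \<and> outputs_perfect_matching F B \<longrightarrow>
             enn2ereal (expected_error F D B) \<ge>
               ereal (c * (real n / \<epsilon>)) * min (ln_inverse \<delta>) (ereal (ln (real m / real n))))))"
proof -
  define s where "s = min 1 \<gamma> / 4"
  have s: "0 < s" using assms by (simp add: s_def)
  \<comment> \<open>Beyond \<open>R\<close> the privacy loss is at most 1/2. Requiring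
    \<open>R \<ge> 2\<close> makes \<open>ln R\<close> positive.\<close>
  obtain R where R: "R \<ge> 2" and loss: "\<And>x. x \<ge> R \<Longrightarrow>
      2 * exp \<epsilon> * x powr (s - 1) + exp (2 * \<epsilon>) / \<epsilon> * x powr (2 * s - \<gamma>) \<le> 1 / 2"
    using eventually_privacy_loss_le[OF assms] unfolding s_def eventually_at_top_linorder
    by (metis max.bounded_iff max.cobounded2)
  \<comment> \<open>Since the ratio exceeds 2, \<delta> is at most \<open>2 powr - \<gamma>\<close>,
    which is less than 1. So \<open>q\<close> bounds the missing probability from below for all
    admissible \<delta>.\<close>
  define q where "q = (1 - 2 powr - \<gamma>) / (1 + exp \<epsilon>)"
  have q: "0 < q"
    using assms powr_less_mono[of "- \<gamma>" 0 2] by (auto simp: q_def add_pos_pos intro!: divide_pos_pos)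
  \<comment> \<open>The factor s/32 is s/4 from \<open>W\<close>, 1/4 from the complete blocks and
    1/2 from the missing probability. In the other term, 1/16 is the scale 1/4 times the same 1/4,
    \<epsilon> cancels the division in the claim, and \<open>ln R\<close> bounds the logarithm of a
    ratio below \<open>R\<close>.\<close>
  define c where "c = min (s / 32) (\<epsilon> * q / (16 * ln R))"
  have c: "0 < c" using s q R assms by (simp add: c_def)
  show ?thesis
  proof (intro exI[of _ c] conjI allI impI c, elim conjE)
    fix n m :: nat and \<delta> :: real
    assume nm: "even n" "2 * n < m" "m \<le> n choose 2"
      and \<delta>: "0 \<le> \<delta>" "\<delta> \<le> 1" "\<delta> \<le> (real n / real m) powr \<gamma>"
    define x where "x = real m / real n"
    have n0: "0 < n" using nm by (intro gr0I) (simp add: binomial_eq_0)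
    have x: "2 < x" using nm n0 by (simp add: x_def pos_less_divide_eq)
    then have x1: "1 \<le> x" by simp
    have \<delta>x: "\<delta> \<le> x powr - \<gamma>"
      using \<delta>(3) n0 nm by (simp add: x_def powr_minus powr_divide)
    obtain F where F: "planted_matching (n div 2) (m div n) F" "connected_graph F"
      "verts F = {..<n}" "card (edges F) = m"
      using exists_planted_matching_graph[OF nm] .
    interpret planted_matching "n div 2" "m div n" F by (rule F(1))
    let ?N = "real (n div 2 div (m div n) * (m div n))"
    have N: "real n / 4 \<le> ?N" using nm n0 by (intro quarter_le_blocks) auto
    have d: "x / 2 \<le> real (m div n)" using half_le_div[OF n0 nm(2)] by (simp add: x_def)
    then have "1 < real (m div n)" using x by linarith
    then have d2: "2 \<le> m div n" by linarith
    \<comment> \<open>The scale is fixed before the algorithm, so one distribution works against all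
      of them.\<close>
    have "\<exists>W. \<forall>B. differentially_private \<epsilon> \<delta> F B \<and> outputs_perfect_matching F B \<longrightarrow>
        ennreal (c * (real n / \<epsilon>) * ln x) \<le> expected_error F (weight_distribution W) B"
    proof (cases "x < R")
      case True
      have "\<delta> \<le> 2 powr - \<gamma>"
        using \<delta>x powr_mono2'[of "- \<gamma>" 2 x] x assms by linarith
      then have q_le: "q \<le> (1 - \<delta>) / (1 + exp \<epsilon>)"
        by (auto simp: q_def add_pos_pos intro!: divide_right_mono)
      have "c * (real n / \<epsilon>) * ln x \<le> \<epsilon> * q / (16 * ln R) * (real n / \<epsilon>) * ln R"
        using True x assms q R by (intro mult_mono) (auto simp: c_def)
      also have "\<dots> = 1 / 4 * (real n / 4 * q)" using assms R by (simp add: field_simps)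
      also have "\<dots> \<le> 1 / 4 * (?N * ((1 - \<delta>) / (1 + exp \<epsilon>)))"
        using N q_le q by (intro mult_left_mono mult_mono) auto
      finally show ?thesis
        using expected_error_ge_few_choices[OF _ _ \<delta>(2) d2]
        by (meson ennreal_leI order_trans)
    next
      case False
      define W where "W = s * ln x / (4 * \<epsilon>)"
      define k where "k = nat \<lfloor>4 * W\<rfloor>"
      have W0: "0 \<le> W" using s x assms by (simp add: W_def)
      have "4 * W \<le> real (Suc k)" unfolding k_def using W0 by linarith
      moreover have "1 / 2 \<le> 1 - exp (\<epsilon> * Suc k) / (m div n) - Suc k * exp (\<epsilon> * Suc k) * \<delta>"
        using privacy_loss_le[OF assms(1) x1 \<delta>(1) \<delta>x d less_imp_le[OF s] W_def k_def] loss[of x] False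
        by linarith
      ultimately have *: "ennreal (W * (?N * (1 / 2))) \<le> expected_error F (weight_distribution W) B"
        if "differentially_private \<epsilon> \<delta> F B" "outputs_perfect_matching F B" for B
        using that assms \<delta> W0 by (intro expected_error_ge_many_choices) auto
      have "c * (real n / \<epsilon>) * ln x \<le> s / 32 * (real n / \<epsilon>) * ln x"
        using x assms by (intro mult_right_mono) (auto simp: c_def)
      also have "\<dots> = W * (real n / 4 * (1 / 2))" by (simp add: W_def)
      also have "\<dots> \<le> W * (?N * (1 / 2))"
        using N W0 by (intro mult_left_mono mult_right_mono) auto
      finally show ?thesis using * by (meson ennreal_leI order_trans)
    qed
    then obtain W where W: "\<And>B. differentially_private \<epsilon> \<delta> F B \<Longrightarrow> outputs_perfect_matching F B \<Longrightarrow>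
        ennreal (c * (real n / \<epsilon>) * ln x) \<le> expected_error F (weight_distribution W) B" by blast
    have "ereal (c * (real n / \<epsilon>)) * min (ln_inverse \<delta>) (ereal (ln (real m / real n)))
        \<le> enn2ereal (expected_error F (weight_distribution W) B)"
      if "differentially_private \<epsilon> \<delta> F B" "outputs_perfect_matching F B" for B
    proof -
      \<comment> \<open>Bounding the minimum by its second argument also covers \<delta> = 0, where
        the first one is infinite.\<close>
      have "ereal (c * (real n / \<epsilon>)) * min (ln_inverse \<delta>) (ereal (ln (real m / real n)))
          \<le> ereal (c * (real n / \<epsilon>)) * ereal (ln x)"
        using c assms by (intro ereal_mult_left_mono) (auto simp: x_def)
      also have "\<dots> = enn2ereal (ennreal (c * (real n / \<epsilon>) * ln x))"
        using c assms x by (simp add: enn2ereal_ennreal)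
      also have "\<dots> \<le> enn2ereal (expected_error F (weight_distribution W) B)"
        using W[OF that] by (simp add: less_eq_ennreal.rep_eq)
      finally show ?thesis .
    qed
    moreover have "sets (weight_distribution W) = sets (weight_space F)"
      by (simp add: weight_distribution_def)
    ultimately show "\<exists>(F :: nat graph) D.
        simple_graph F \<and> connected_graph F \<and>
        card (verts F) = n \<and> card (edges F) = m \<and> (\<exists>M. perfect_matching F M) \<and>
        prob_space D \<and> sets D = sets (weight_space F) \<and>
        (\<forall>B. differentially_private \<epsilon> \<delta> F B \<and> outputs_perfect_matching F B \<longrightarrow>
           enn2ereal (expected_error F D B) \<ge>
             ereal (c * (real n / \<epsilon>)) * min (ln_inverse \<delta>) (ereal (ln (real m / real n))))"
      using F simple_F prob_space_weight_distribution[of W]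
        perfect_matching_planted[OF id_block_perms]
      by (intro exI[of _ F] exI[of _ "weight_distribution W"]) auto
  qed
qed

end
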